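(* Let $b>0$ and let $f:[0,b]\to\mathbb{R}$ be a non-negative, non-decreasing continuous function. Extend $f$ to $[0,\infty)$ by setting $f(x)=f(b)$ for $x>b$. For each integer $n\ge 1$, define the rational function $$R_n(f;x)=\sum_{k=0}^n f\left(\frac{bk}{n+1-k}\right)\binom{n}{k}\frac{b^{\,n-k}x^k}{(b+x)^n},\quad x\in[0,b].$$ Then: 1. $R_n(f;x)$ is continuous and the ratio of polynomials with non-negative coefficients. 2. $R_n(f;x)$ is non-decreasing on $[0,b]$. 3. As $n\to\infty$, $R_n(f;x)$ converges uniformly to $f(x)$ on $[0,b]$. *)

theory Defs
  imports "HOL-Analysis.Analysis" "HOL-Computational_Algebra.Polynomial"
begin

definition const_extension :: "real \<Rightarrow> (real \<Rightarrow> real) \<Rightarrow> real \<Rightarrow> real" where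
  "const_extension b f x = (if x > b then f b else f x)"

text \<open>
  A function on \<open>[0, b]\<close> is a total function \<open>f\<close> of which only the values on \<open>{0..b}\<close> matter:
  for \<open>b > 0\<close> all nodes below are non-negative, and a node exceeding \<open>b\<close> is handled by the extension.
  The denominator \<open>n + 1 - k\<close> is a real subtraction, with value at least 1 for \<open>k \<le> n\<close>.
\<close>

definition R :: "real \<Rightarrow> nat \<Rightarrow> (real \<Rightarrow> real) \<Rightarrow> real \<Rightarrow> real" where
  "R b n f x =
     (\<Sum>k = 0..n. const_extension b f (b * real k / (real n + 1 - real k)) *
        real (n choose k) * (b ^ (n - k) * x ^ k / (b + x) ^ n))"

text \<open>
  Equality with the quotient is only required on \<open>S\<close>, where the denominator must not vanish
  (division by zero is total in HOL).
\<close>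

definition ratio_of_nonneg_polys_on :: "real set \<Rightarrow> (real \<Rightarrow> real) \<Rightarrow> bool" where
  "ratio_of_nonneg_polys_on S g \<longleftrightarrow>
     (\<exists>p q :: real poly. (\<forall>i. coeff p i \<ge> 0) \<and> (\<forall>i. coeff q i \<ge> 0) \<and>
        (\<forall>x\<in>S. poly q x \<noteq> 0 \<and> g x = poly p x / poly q x))"

end

theory Submission imports Defs begin

text \<open>
  Under the substitution \<open>p = x / (b + x)\<close>, i.e. \<open>x = b p / (1 - p)\<close>, the operator \<open>R\<close> becomes
  a Bernstein sum on \<open>[0, 1/2]\<close> whose nodes are \<open>k / (n + 1)\<close> instead of \<open>k / n\<close>.
  A Bernstein sum with non-decreasing coefficients is non-decreasing, and by uniform continuity
  the displacement of the nodes is harmless for Bernstein's convergence theorem.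
\<close>

text \<open>Pascal's rule, or equivalently conditioning on one of \<open>Suc n\<close> Bernoulli
  trials: failure leaves the index alone, success shifts it by one. This drives the induction in
  \<open>mono_Bernstein_sum\<close>.\<close>

lemma Bernstein_sum_Suc:
  "(\<Sum>k\<le>Suc n. g k * Bernstein (Suc n) k p) =
     (1 - p) * (\<Sum>k\<le>n. g k * Bernstein n k p) + p * (\<Sum>k\<le>n. g (Suc k) * Bernstein n k p)"
proof -
  have "(\<Sum>k\<le>Suc n. g k * Bernstein (Suc n) k p) =
      (\<Sum>k\<le>Suc n. g k * real (n choose k) * p ^ k * (1 - p) ^ (Suc n - k))
      + (\<Sum>k\<le>n. g (Suc k) * real (n choose k) * p ^ Suc k * (1 - p) ^ (n - k))"
    unfolding sum.atMost_Suc_shift Bernstein_def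
    by (simp add: sum.distrib [symmetric] algebra_simps)
  \<comment> \<open>The top term \<open>k = Suc n\<close> vanishes because
    \<open>n choose Suc n = 0\<close>.\<close>
  also have "(\<Sum>k\<le>Suc n. g k * real (n choose k) * p ^ k * (1 - p) ^ (Suc n - k))
      = (1 - p) * (\<Sum>k\<le>n. g k * Bernstein n k p)"
    by (auto simp: Bernstein_def sum_distrib_left Suc_diff_le binomial_eq_0 intro!: sum.cong)
  also have "(\<Sum>k\<le>n. g (Suc k) * real (n choose k) * p ^ Suc k * (1 - p) ^ (n - k))
      = p * (\<Sum>k\<le>n. g (Suc k) * Bernstein n k p)"
    by (auto simp: Bernstein_def sum_distrib_left intro!: sum.cong)
  finally show ?thesis .
qed

text \<open>No derivative is taken. By the recursion the sum is a convex combination of two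
  lower-degree sums, with coefficients \<open>g k\<close> and \<open>g (Suc k)\<close>. Going from
  \<open>p\<close> to \<open>q\<close> raises both and moves weight to the larger one. The induction
  generalises over \<open>g\<close> to cover the shifted coefficients.\<close>

lemma mono_Bernstein_sum:
  assumes "0 \<le> p" "p \<le> q" "q \<le> 1" "\<And>k. k < n \<Longrightarrow> g k \<le> g (Suc k)"
  shows "(\<Sum>k\<le>n. g k * Bernstein n k p) \<le> (\<Sum>k\<le>n. g k * Bernstein n k q)"
  using assms(4)
proof (induction n arbitrary: g)
  case 0
  then show ?case by (simp add: Bernstein_def)
next
  case (Suc n)
  define A where "A = (\<lambda>p. \<Sum>k\<le>n. g k * Bernstein n k p)"
  define C where "C = (\<lambda>p. \<Sum>k\<le>n. g (Suc k) * Bernstein n k p)"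
  have "A p \<le> A q" unfolding A_def by (rule Suc.IH) (simp add: Suc.prems)
  moreover have "C p \<le> C q" unfolding C_def by (rule Suc.IH) (simp add: Suc.prems)
  ultimately have "(1 - p) * A p + p * C p \<le> (1 - p) * A q + p * C q"
    using assms by (intro add_mono mult_left_mono) auto
  moreover have "A q \<le> C q"
    unfolding A_def C_def using assms Suc.prems
    by (intro sum_mono mult_right_mono Bernstein_nonneg) auto
  \<comment> \<open>The arguments have moved under fixed weights; now the weights move, which gains
    because \<open>C q - A q\<close> is non-negative.\<close>
  then have "p * (C q - A q) \<le> q * (C q - A q)"
    using assms by (intro mult_right_mono) auto
  ultimately have "(1 - p) * A p + p * C p \<le> (1 - q) * A q + q * C q"
    by (simp add: algebra_simps)
  then show ?case unfolding Bernstein_sum_Suc A_def C_def .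
qed

lemma R_eq_Bernstein_sum:
  assumes "b > 0" "x \<ge> 0"
  shows "R b n f x = (\<Sum>k\<le>n. const_extension b f (b * real k / (real n + 1 - real k)) *
    Bernstein n k (x / (b + x)))"
proof -
  have "b ^ (n - k) * x ^ k / (b + x) ^ n = (x / (b + x)) ^ k * (1 - x / (b + x)) ^ (n - k)"
    if "k \<le> n" for k
  proof -
    have "1 - x / (b + x) = b / (b + x)" using assms by (simp add: field_simps)
    \<comment> \<open>Of the \<open>n\<close> factors below, \<open>k\<close> go with
      \<open>x\<close> and \<open>n - k\<close> with \<open>b\<close>.\<close>
    moreover have "(b + x) ^ n = (b + x) ^ k * (b + x) ^ (n - k)"
      using that by (simp flip: power_add)
    ultimately show ?thesis by (simp add: power_divide)
  qed
  then show ?thesis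
    unfolding R_def Bernstein_def atMost_atLeast0 by (intro sum.cong) auto
qed

lemma coeff_mult_nonneg:
  fixes p q :: "'a :: linordered_idom poly"
  assumes "\<And>i. coeff p i \<ge> 0" "\<And>i. coeff q i \<ge> 0"
  shows "coeff (p * q) i \<ge> 0"
  unfolding coeff_mult using assms by (intro sum_nonneg) simp

lemma coeff_power_nonneg:
  fixes p :: "'a :: linordered_idom poly"
  assumes "\<And>i. coeff p i \<ge> 0"
  shows "coeff (p ^ n) i \<ge> 0"
proof (induction n arbitrary: i)
  case (Suc n)
  then show ?case using assms by (simp add: coeff_mult_nonneg)
qed (simp add: coeff_1)

text \<open>As a clamp, the extension is visibly monotone in the node, and non-negative nodes land
  in \<open>{0..b}\<close>, where the hypotheses on \<open>f\<close> apply.\<close>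

lemma const_extension_eq_min: "const_extension b f x = f (min b x)"
  by (simp add: const_extension_def min_def)

lemma R_node_mono:
  assumes "b > 0" "j \<le> k" "k \<le> n"
  shows "b * real j / (real n + 1 - real j) \<le> b * real k / (real n + 1 - real k)"
  using assms by (intro frac_le mult_left_mono) auto

lemma continuous_on_R:
  assumes "b > 0"
  shows "continuous_on {0..b} (R b n f)"
  unfolding R_def [abs_def] using assms by (auto intro!: continuous_intros)

lemma R_ratio_of_nonneg_polys:
  assumes "b > 0" "\<And>x. x \<in> {0..b} \<Longrightarrow> f x \<ge> 0"
  shows "ratio_of_nonneg_polys_on {0..b} (R b n f)"
proof -
  \<comment> \<open>Everything in the \<open>k\<close>-th summand free of \<open>x\<close>: these
    are the numerator's coefficients, over the denominator \<open>(b + x) ^ n\<close>.\<close>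
  define c where "c k = const_extension b f (b * real k / (real n + 1 - real k)) *
    real (n choose k) * b ^ (n - k)" for k
  have c: "c k \<ge> 0" if "k \<le> n" for k
    using assms that unfolding c_def const_extension_eq_min by (auto intro!: mult_nonneg_nonneg)
  define p where "p = (\<Sum>k\<le>n. monom (c k) k)"
  define q where "q = [:b, 1:] ^ n"
  have "coeff p i \<ge> 0" for i
    unfolding p_def by (auto simp: coeff_sum intro!: sum_nonneg c)
  moreover have "coeff q i \<ge> 0" for i
    unfolding q_def using assms(1)
    by (intro coeff_power_nonneg) (auto simp: coeff_pCons split: nat.split)
  moreover have "poly q x \<noteq> 0 \<and> R b n f x = poly p x / poly q x" if "x \<in> {0..b}" for x
    using assms(1) that
    by (simp add: p_def q_def R_def c_def poly_sum poly_monom sum_divide_distrib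
        atMost_atLeast0 mult_ac add.commute)
  ultimately show ?thesis unfolding ratio_of_nonneg_polys_on_def by blast
qed

lemma mono_on_R:
  assumes "b > 0" "mono_on {0..b} f"
  shows "mono_on {0..b} (R b n f)"
proof (rule mono_onI)
  fix x y assume xy: "x \<in> {0..b}" "y \<in> {0..b}" "x \<le> y"
  have "const_extension b f (b * real k / (real n + 1 - real k))
      \<le> const_extension b f (b * real (Suc k) / (real n + 1 - real (Suc k)))" if "k < n" for k
    unfolding const_extension_eq_min using R_node_mono[of b k "Suc k" n] assms that
    by (intro mono_onD[OF assms(2)]) (auto intro!: min.mono divide_nonneg_nonneg)
  moreover have "x / (b + x) \<le> y / (b + y)"
    using xy assms(1) by (simp add: field_simps)
  ultimately show "R b n f x \<le> R b n f y"
    using xy assms(1) by (auto simp: R_eq_Bernstein_sum intro!: mono_Bernstein_sum)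
qed

text \<open>The error is split in two halves: moving the nodes from \<open>k / (n + 1)\<close> to
  \<open>k / n\<close>, and Bernstein approximation of the transported function
  \<open>G\<close>.\<close>

lemma uniform_limit_R:
  assumes "b > 0" "continuous_on {0..b} f"
  shows "uniform_limit {0..b} (\<lambda>n. R b n f) f sequentially"
proof (rule uniform_limitI)
  fix e :: real assume "e > 0"
  \<comment> \<open>The inverse of \<open>x / (b + x)\<close>, frozen from \<open>1 / 2\<close> on,
    the image of \<open>b\<close>. This avoids the pole at 1 and mirrors the constant extension, so
    \<open>G\<close> is continuous on all of \<open>{0..1}\<close>.\<close>
  define h where "h t = b * min t (1 / 2) / (1 - min t (1 / 2))" for t :: real
  define G where "G = f \<circ> h"
  have h_range: "h t \<in> {0..b}" if "t \<in> {0..1}" for t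
  proof -
    define u where "u = min t (1 / 2)"
    have u: "0 \<le> u" "u \<le> 1 / 2" using that by (auto simp: u_def)
    then have "b * u \<le> b * (1 - u)" using assms(1) by (intro mult_left_mono) auto
    then show ?thesis using u assms(1) unfolding h_def u_def [symmetric]
      by (auto simp: field_simps)
  qed
  have "continuous_on {0..1} h"
    unfolding h_def by (intro continuous_intros) (auto simp: min_def split: if_splits)
  then have G_cont: "continuous_on {0..1} G"
    unfolding G_def using h_range
    by (intro continuous_on_compose continuous_on_subset[OF assms(2)]) auto
  then have "uniformly_continuous_on {0..1} G"
    by (intro compact_uniformly_continuous) auto
  then obtain d where "d > 0" and
    d: "\<And>s t. s \<in> {0..1} \<Longrightarrow> t \<in> {0..1} \<Longrightarrow> dist t s < d \<Longrightarrow> dist (G t) (G s) < e / 2"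
    using \<open>e > 0\<close> unfolding uniformly_continuous_on_def by (metis half_gt_zero)
  obtain N where
    N: "\<And>n x. N \<le> n \<and> x \<in> {0..1} \<Longrightarrow>
      \<bar>G x - (\<Sum>k\<le>n. G (real k / real n) * Bernstein n k x)\<bar> < e / 2"
    using Bernstein_Weierstrass[OF G_cont half_gt_zero[OF \<open>e > 0\<close>]] by blast
  \<comment> \<open>At \<open>t = k / (n + 1)\<close> the formula \<open>b * t / (1 - t)\<close>
    gives exactly the node of \<open>R\<close>. It exceeds \<open>b\<close> iff
    \<open>t > 1 / 2\<close>, so the two clamps act together.\<close>
  have G_node: "const_extension b f (b * real k / (real n + 1 - real k)) = G (real k / (real n + 1))"
    if "k \<le> n" for k n
  proof (cases "2 * real k \<le> real n + 1")
    case True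
    then have "min (real k / (real n + 1)) (1 / 2) = real k / (real n + 1)"
      by (simp add: field_simps min_def)
    then have "h (real k / (real n + 1)) = b * real k / (real n + 1 - real k)"
      using that by (simp add: h_def field_simps)
    moreover have "b * real k / (real n + 1 - real k) \<le> b"
      using True that assms(1) by (simp add: pos_divide_le_eq)
    ultimately show ?thesis by (simp add: const_extension_eq_min G_def min_absorb2)
  next
    case False
    then have "min (real k / (real n + 1)) (1 / 2) = 1 / 2"
      by (simp add: field_simps min_def)
    then have "h (real k / (real n + 1)) = b" unfolding h_def by (simp only:) simp
    moreover have "b \<le> b * real k / (real n + 1 - real k)"
      using False that assms(1) by (simp add: pos_le_divide_eq)
    ultimately show ?thesis by (simp add: const_extension_eq_min G_def min_absorb1)
  qed
  have "eventually (\<lambda>n. inverse (real n) < d) sequentially"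
    using lim_inverse_n[where 'a = real] \<open>d > 0\<close> by (auto dest: order_tendstoD(2))
  then show "\<forall>\<^sub>F n in sequentially. \<forall>x\<in>{0..b}. dist (R b n f x) (f x) < e"
    using eventually_ge_at_top[of N] eventually_gt_at_top[of 0]
  proof eventually_elim
    case (elim n)
    show ?case
    proof
      fix x assume x: "x \<in> {0..b}"
      define p where "p = x / (b + x)"
      have p: "0 \<le> p" "p \<le> 1" "p \<le> 1 / 2" using x assms(1) by (auto simp: p_def field_simps)
      have "1 - p = b / (b + x)" using x assms(1) by (simp add: p_def field_simps)
      \<comment> \<open>Since \<open>p \<le> 1 / 2\<close>, the clamp in \<open>h\<close> is
        inactive.\<close>
      then have "h p = x" using p x assms(1) by (simp add: h_def min_absorb1) (simp add: p_def)
      then have "G p = f x" by (simp add: G_def)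
      have node: "\<bar>G (real k / (real n + 1)) - G (real k / real n)\<bar> \<le> e / 2" if "k \<le> n" for k
      proof -
        \<comment> \<open>The displacement is below \<open>1 / n\<close> uniformly in
          \<open>k\<close>, hence below the modulus \<open>d\<close>.\<close>
        have "real k / real n - real k / (real n + 1) = real k / (real n + 1) * inverse (real n)"
          using elim by (simp add: field_simps)
        also have "\<dots> \<le> 1 * inverse (real n)"
          using that by (intro mult_right_mono) auto
        finally have "real k / real n - real k / (real n + 1) < d" using elim by simp
        moreover have "real k / (real n + 1) \<le> real k / real n"
          using elim by (intro divide_left_mono) auto
        ultimately have "dist (real k / (real n + 1)) (real k / real n) < d"
          by (simp add: dist_real_def)
        then have "dist (G (real k / (real n + 1))) (G (real k / real n)) < e / 2"
          using that elim by (intro d) auto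
        then show ?thesis by (simp add: dist_real_def)
      qed
      have "R b n f x = (\<Sum>k\<le>n. G (real k / (real n + 1)) * Bernstein n k p)"
        using x assms(1) G_node by (simp add: R_eq_Bernstein_sum p_def)
      then have "\<bar>R b n f x - (\<Sum>k\<le>n. G (real k / real n) * Bernstein n k p)\<bar>
          = \<bar>\<Sum>k\<le>n. (G (real k / (real n + 1)) - G (real k / real n)) * Bernstein n k p\<bar>"
        by (simp add: sum_subtractf left_diff_distrib)
      \<comment> \<open>The Bernstein weights are non-negative and sum to 1, so the node errors are
        averaged. The bound is not strict, but the other half of the error is.\<close>
      also have "\<dots> \<le> (\<Sum>k\<le>n. e / 2 * Bernstein n k p)"
        using p
        by (intro order_trans[OF sum_abs] sum_mono, unfold abs_mult)
          (auto simp only: abs_of_nonneg Bernstein_nonneg atMost_iff intro!: mult_right_mono node)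
      also have "\<dots> = e / 2" by (simp only: sum_distrib_left [symmetric] sum_Bernstein mult_1_right)
      finally have "\<bar>R b n f x - (\<Sum>k\<le>n. G (real k / real n) * Bernstein n k p)\<bar> \<le> e / 2" .
      moreover have "\<bar>G p - (\<Sum>k\<le>n. G (real k / real n) * Bernstein n k p)\<bar> < e / 2"
        using N elim p by auto
      ultimately show "dist (R b n f x) (f x) < e"
        unfolding dist_real_def \<open>G p = f x\<close> by linarith
    qed
  qed
qed

theorem theorem3p1:
  fixes b :: real and f :: "real \<Rightarrow> real"
  assumes "b > 0"
    and "\<And>x. x \<in> {0..b} \<Longrightarrow> f x \<ge> 0"
    and "mono_on {0..b} f"
    and "continuous_on {0..b} f"
  shows "(\<forall>n\<ge>1. continuous_on {0..b} (R b n f) \<and> ratio_of_nonneg_polys_on {0..b} (R b n f)) \<and>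
    (\<forall>n\<ge>1. mono_on {0..b} (R b n f)) \<and>
    uniform_limit {0..b} (\<lambda>n. R b n f) f sequentially"
  using assms by (auto intro: continuous_on_R R_ratio_of_nonneg_polys mono_on_R uniform_limit_R)

end
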